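(* Let $v\ge 1$, $k\ge 1$ and $0\le t\le k$ be integers, and let $M=M_t(v,k)$ be the $t$-inclusion matrix defined in the context, regarded as a matrix over the real numbers. Then \[ \operatorname{rank}(M)=\sum_{i=0}^{t}\binom{k}{i}(v-1)^i . \]
   Context: Let $V=\{0,1,\ldots,v-1\}$ and $V^k$ the set of ordered $k$-tuples of elements of $V$. For a $t$-subset $I=\{i_1<\cdots<i_t\}$ of $\{1,\ldots,k\}$, let $V^t_I=\{(u_1,\ldots,u_t)_I : u_j\in V\}$ (tuples labelled by $I$). Say $(u_1,\ldots,u_t)_I\in(x_1,\ldots,x_k)$ iff $u_j=x_{i_j}$ for $j=1,\ldots,t$. The $t$-inclusion matrix $M_t(v,k)$ has columns indexed by $V^k$ and rows indexed by $\bigcup_I V^t_I$, the union over all $t$-subsets $I$ of $\{1,\ldots,k\}$; the entry in row $(u_1,\ldots,u_t)_I$ and column $(x_1,\ldots,x_k)$ is $1$ if $(u_1,\ldots,u_t)_I\in(x_1,\ldots,x_k)$ and $0$ otherwise. *)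

theory Defs
  imports "Jordan_Normal_Form.DL_Rank"
begin

text \<open>
  A tuple over \<open>{0..<v}\<close> is a list. Coordinates of tuples are numbered from 1, list positions from 0,
  so the \<open>i\<close>-th coordinate of \<open>x\<close> is \<open>x ! (i - 1)\<close>.
\<close>

definition tuples :: "nat \<Rightarrow> nat \<Rightarrow> nat list set" where
  "tuples v k = {x. length x = k \<and> set x \<subseteq> {0..<v}}"

text \<open>The pair \<open>(I, u)\<close> stands for the tuple \<open>u\<close> labelled by \<open>I\<close>.\<close>

definition labelled_tuples :: "nat \<Rightarrow> nat \<Rightarrow> nat \<Rightarrow> (nat set \<times> nat list) set" where
  "labelled_tuples t v k = {(I, u). I \<subseteq> {1..k} \<and> card I = t \<and> u \<in> tuples v t}"

text \<open>\<open>sorted_list_of_set I ! j\<close> is the \<open>(j + 1)\<close>-st smallest element of \<open>I\<close>.\<close>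

definition included_in :: "nat set \<times> nat list \<Rightarrow> nat list \<Rightarrow> bool" where
  "included_in = (\<lambda>(I, u) x. \<forall>j < card I. u ! j = x ! (sorted_list_of_set I ! j - 1))"

text \<open>
  Matrices of the library are indexed by initial segments of the naturals, so an order of the rows
  and of the columns has to be chosen: the lists \<open>rs\<close> and \<open>cs\<close> enumerate the labelled tuples and
  the tuples, each exactly once, and \<open>inclusion_mat rs cs\<close> is the inclusion matrix in that order.
\<close>

definition enumerates :: "'a list \<Rightarrow> 'a set \<Rightarrow> bool" where
  "enumerates xs A \<longleftrightarrow> distinct xs \<and> set xs = A"

definition inclusion_mat :: "(nat set \<times> nat list) list \<Rightarrow> nat list list \<Rightarrow> real mat" where
  "inclusion_mat rs cs =
     mat (length rs) (length cs) (\<lambda>(i, j). if included_in (rs ! i) (cs ! j) then 1 else 0)"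

lemma ex_enumerates_tuples: "\<exists>cs. enumerates cs (tuples v k)"
  using finite_lists_length_eq[of "{0..<v}" k] finite_distinct_list[of "tuples v k"]
  by (auto simp: enumerates_def tuples_def conj_commute)

lemma ex_enumerates_labelled_tuples: "\<exists>rs. enumerates rs (labelled_tuples t v k)"
proof -
  have "finite (tuples v t)"
    using ex_enumerates_tuples[of v t] by (auto simp: enumerates_def intro: finite_set dest: sym)
  then have "finite (Pow {1..k} \<times> tuples v t)" by simp
  then have "finite (labelled_tuples t v k)"
    by (rule finite_subset[rotated]) (auto simp: labelled_tuples_def)
  then show ?thesis using finite_distinct_list by (auto simp: enumerates_def)
qed

end

theory Submission imports Defs begin

text \<open>
  The columns of the tuples with at most \<open>t\<close> nonzero entries form a basis of the column space.
  They span: if \<open>x\<close> has a set \<open>T\<close> of \<open>t + 1\<close> nonzero coordinates, the alternating sum over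
  \<open>J \<subseteq> T\<close> of the columns of \<open>x\<close> with the coordinates in \<open>J\<close> replaced by 0 vanishes, which expresses
  the column of \<open>x\<close> through columns of smaller weight. They are independent because the rows are
  triangular with respect to the weight.
\<close>

section \<open>Rank from a spanning family of columns\<close>

context vec_space begin

text \<open>Entrywise form of a linear combination over an index set; unlike with
  \<open>lincomb\<close> over a set of vectors, \<open>f\<close> may repeat values.\<close>

lemma vec_sum_in_span:
  assumes "S \<subseteq> carrier_vec n" "finite Y" "f ` Y \<subseteq> span S"
  shows "vec n (\<lambda>i. \<Sum>y\<in>Y. c y * f y $ i) \<in> span S"
  using assms(2,3)
proof (induction Y)
  case empty
  have "vec n (\<lambda>i. \<Sum>y\<in>{}. c y * f y $ i) = 0\<^sub>v n" by auto
  then show ?case using vectorspace.span_zero[OF vectorspace_axioms] by simp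
next
  case (insert y Y)
  have y: "f y \<in> span S" using insert.prems by auto
  then have yc: "f y \<in> carrier_vec n" using span_closed[OF assms(1)] by simp
  have "vec n (\<lambda>i. \<Sum>z\<in>insert y Y. c z * f z $ i)
      = c y \<cdot>\<^sub>v f y + vec n (\<lambda>i. \<Sum>z\<in>Y. c z * f z $ i)"
    using insert.hyps yc by (intro eq_vecI) auto
  moreover have "c y \<cdot>\<^sub>v f y \<in> span S"
    by (rule smult_in_span[OF assms(1) y])
  moreover have "vec n (\<lambda>i. \<Sum>z\<in>Y. c z * f z $ i) \<in> span S"
    using insert by auto
  ultimately show ?case using span_add1[of S] assms(1) by simp
qed

text \<open>Independence is demanded of the family rather than of its image: this forces
  \<open>f\<close> to be injective, so that the rank counts indices. An independent set of columns
  that spans all columns is a maximal one, and such a set has \<open>rank A\<close>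
  elements.\<close>

lemma rank_eq_card_family:
  assumes A: "A \<in> carrier_mat n nc"
    and fin: "finite X"
    and sub: "f ` X \<subseteq> set (cols A)"
    and span: "set (cols A) \<subseteq> span (f ` X)"
    and indpt: "\<And>c x. (\<And>i. i < n \<Longrightarrow> (\<Sum>x\<in>X. c x * f x $ i) = 0) \<Longrightarrow> x \<in> X \<Longrightarrow> c x = 0"
  shows "rank A = card X"
proof -
  have cols: "set (cols A) \<subseteq> carrier_vec n" using A cols_dim[of A] by auto
  then have fX: "f ` X \<subseteq> carrier_vec n" using sub by auto
  have inj: "inj_on f X"
  proof (rule inj_onI, rule ccontr)
    fix x y assume xy: "x \<in> X" "y \<in> X" "f x = f y" "x \<noteq> y"
    \<comment> \<open>Coefficients of the relation \<open>f x - f y = 0\<close>.\<close>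
    define c :: "'b \<Rightarrow> 'a" where "c = (\<lambda>z. (if z = x then 1 else 0) - (if z = y then 1 else 0))"
    have "(\<Sum>z\<in>X. c z * f z $ i) = 0" for i
    proof -
      have "(\<Sum>z\<in>X. c z * f z $ i)
          = (\<Sum>z\<in>X. if z = x then f z $ i else 0) - (\<Sum>z\<in>X. if z = y then f z $ i else 0)"
        unfolding sum_subtractf[symmetric] by (rule sum.cong) (auto simp: c_def)
      then show ?thesis using xy fin by simp
    qed
    then have "c x = 0" using indpt xy(1) by blast
    then show False using xy(4) by (simp add: c_def)
  qed
  have li: "lin_indpt (f ` X)"
  proof
    assume "lin_dep (f ` X)"
    then obtain B a v where B: "finite B" "B \<subseteq> f ` X" "lincomb a B = 0\<^sub>v n" "v \<in> B" "a v \<noteq> 0"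
      unfolding lin_dep_def by auto
    obtain x where x: "x \<in> X" "v = f x" using B by auto
    \<comment> \<open>The dependency on \<open>B\<close>, pulled back along \<open>f\<close> and
      extended by 0.\<close>
    define c where "c = (\<lambda>x. if f x \<in> B then a (f x) else 0)"
    have "(\<Sum>x\<in>X. c x * f x $ i) = 0" if i: "i < n" for i
    proof -
      have "(\<Sum>x\<in>X. c x * f x $ i) = (\<Sum>w\<in>f ` X. (if w \<in> B then a w else 0) * w $ i)"
        unfolding sum.reindex[OF inj] c_def by simp
      also have "\<dots> = (\<Sum>w\<in>B. a w * w $ i)"
        using B fin by (intro sum.mono_neutral_cong_right) auto
      also have "\<dots> = lincomb a B $ i"
        using lincomb_index[OF i, of B a] B fX by auto
      finally show ?thesis using B i by simp
    qed
    then have "c x = 0" using indpt x by blast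
    then show False using B x by (simp add: c_def)
  qed
  have "maximal (f ` X) (\<lambda>T. T \<subseteq> set (cols A) \<and> lin_indpt T)"
    unfolding maximal_def
  proof (intro conjI allI impI li sub)
    fix T assume T: "f ` X \<subseteq> T \<and> T \<subseteq> set (cols A) \<and> lin_indpt T"
    have "T \<subseteq> f ` X"
    proof (rule ccontr)
      assume "\<not> T \<subseteq> f ` X"
      then obtain v where v: "v \<in> T" "v \<notin> f ` X" by blast
      \<comment> \<open>An extra column \<open>v\<close> would be a combination of the other
        elements of \<open>T\<close>.\<close>
      have "f ` X \<subseteq> T - {v}" using T v by auto
      then have "span (f ` X) \<subseteq> span (T - {v})" by (rule span_is_monotone)
      moreover have "v \<in> span (f ` X)" using T v(1) by (intro subsetD[OF span]) auto
      ultimately have "v \<in> span (T - {v})" by (rule subsetD)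
      moreover have "T \<subseteq> carrier_vec n" "finite T" using T cols finite_subset[of T] by auto
      ultimately have "lin_dep T" using lindep_span[of T] v(1) by auto
      then show False using T by simp
    qed
    then show "T = f ` X" using T by auto
  qed
  then show ?thesis using rank_card_indpt[OF A] card_image[OF inj] by simp
qed

end

section \<open>Tuples of bounded weight\<close>

definition weight :: "nat list \<Rightarrow> nat" where
  "weight x = length (filter (\<lambda>a. a \<noteq> 0) x)"

text \<open>Positions count from 0, whereas label sets lie in \<open>{1..k}\<close>; the image under
  \<open>Suc\<close> translates between them.\<close>

definition supp :: "nat list \<Rightarrow> nat set" where
  "supp x = {i. i < length x \<and> x ! i \<noteq> 0}"

lemma finite_supp [simp]: "finite (supp x)"
  by (simp add: supp_def)

lemma weight_eq_card_supp: "weight x = card (supp x)"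
  by (simp add: weight_def supp_def length_filter_conv_card)

lemma finite_tuples: "finite (tuples v k)"
  using ex_enumerates_tuples[of v k] finite_set by (auto simp: enumerates_def dest: sym)

lemma tuples_Suc: "tuples v (Suc k) = (\<lambda>(a, x). a # x) ` ({0..<v} \<times> tuples v k)"
  by (auto simp: tuples_def length_Suc_conv image_iff)

text \<open>For positive \<open>i\<close>, split by the first entry: a zero leaves weight
  \<open>i\<close> to the tail, each of the \<open>v - 1\<close> nonzero values leaves
  \<open>i - 1\<close>. Pascal's rule combines the two counts.\<close>

lemma card_tuples_weight:
  assumes "v \<ge> 1"
  shows "card {x \<in> tuples v k. weight x = i} = (k choose i) * (v - 1) ^ i"
proof (induction k arbitrary: i)
  case 0
  have "{x \<in> tuples v 0. weight x = i} = (if i = 0 then {[]} else {})"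
    by (auto simp: tuples_def weight_def)
  then show ?case by (simp only:) (cases i; simp)
next
  case (Suc k)
  let ?W = "\<lambda>k i. {x \<in> tuples v k. weight x = i}"
  have fin: "finite (?W k i)" for i using finite_tuples by simp
  have zero: "card ((#) 0 ` ?W k i) = card (?W k i)" for i
    by (rule card_image) (auto intro: inj_onI)
  show ?case
  proof (cases i)
    case 0
    have "?W (Suc k) 0 = (#) 0 ` ?W k 0"
      using assms by (auto simp: tuples_Suc weight_def split: if_splits)
    then show ?thesis using zero Suc 0 by simp
  next
    case (Suc j)
    let ?N = "(\<lambda>(a, x). a # x) ` ({1..<v} \<times> ?W k j)"
    have "?W (Suc k) (Suc j) = (#) 0 ` ?W k (Suc j) \<union> ?N"
    proof (intro equalityI subsetI)
      fix y assume "y \<in> ?W (Suc k) (Suc j)"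
      then obtain a x where y: "y = a # x" "a < v" "x \<in> tuples v k" "weight (a # x) = Suc j"
        by (auto simp: tuples_Suc)
      then show "y \<in> (#) 0 ` ?W k (Suc j) \<union> ?N"
        by (cases "a = 0") (auto simp: weight_def)
    qed (use assms in \<open>auto simp: tuples_Suc weight_def\<close>)
    moreover have "(#) 0 ` ?W k (Suc j) \<inter> ?N = {}" by auto
    ultimately have "card (?W (Suc k) (Suc j)) = card ((#) 0 ` ?W k (Suc j)) + card ?N"
      using fin by (simp add: card_Un_disjoint)
    also have "card ?N = (v - 1) * card (?W k j)"
      by (subst card_image) (auto intro: inj_onI simp: card_cartesian_product)
    finally show ?thesis using zero Suc.IH Suc by (simp add: add_mult_distrib add_mult_distrib2 mult_ac)
  qed
qed

lemma card_tuples_weight_le: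
  assumes "v \<ge> 1"
  shows "card {x \<in> tuples v k. weight x \<le> t} = (\<Sum>i = 0..t. (k choose i) * (v - 1) ^ i)"
proof -
  have "{x \<in> tuples v k. weight x \<le> t} = (\<Union>i\<in>{0..t}. {x \<in> tuples v k. weight x = i})" by auto
  also have "card \<dots> = (\<Sum>i = 0..t. card {x \<in> tuples v k. weight x = i})"
    using finite_tuples by (intro card_UN_disjoint) auto
  finally show ?thesis by (simp only: card_tuples_weight[OF assms])
qed

section \<open>Columns of the inclusion matrix\<close>

text \<open>A row only reads the coordinates in its label set.\<close>

lemma included_in_cong:
  assumes "finite I" "\<And>i. i \<in> I \<Longrightarrow> x ! (i - 1) = y ! (i - 1)"
  shows "included_in (I, u) x \<longleftrightarrow> included_in (I, u) y"
proof -
  have "sorted_list_of_set I ! j \<in> I" if "j < card I" for j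
    using assms(1) that nth_mem[of j "sorted_list_of_set I"] by simp
  then show ?thesis using assms(2) by (auto simp: included_in_def)
qed

text \<open>Describes the row that will isolate the coefficient of \<open>x\<close>. Backwards,
  \<open>x\<close> matches its own restriction, and the congruence carries this over to
  \<open>y\<close>.\<close>

lemma included_in_restriction_iff:
  assumes "finite I"
  shows "included_in (I, map (\<lambda>i. x ! (i - 1)) (sorted_list_of_set I)) y
    \<longleftrightarrow> (\<forall>i\<in>I. y ! (i - 1) = x ! (i - 1))"
proof
  assume L: "included_in (I, map (\<lambda>i. x ! (i - 1)) (sorted_list_of_set I)) y"
  show "\<forall>i\<in>I. y ! (i - 1) = x ! (i - 1)"
  proof
    fix i assume "i \<in> I"
    then obtain j where "j < card I" "sorted_list_of_set I ! j = i"
      using assms by (metis in_set_conv_nth length_sorted_list_of_set set_sorted_list_of_set)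
    then show "y ! (i - 1) = x ! (i - 1)" using L by (auto simp: included_in_def)
  qed
next
  assume "\<forall>i\<in>I. y ! (i - 1) = x ! (i - 1)"
  then have "included_in (I, map (\<lambda>i. x ! (i - 1)) (sorted_list_of_set I)) y
    \<longleftrightarrow> included_in (I, map (\<lambda>i. x ! (i - 1)) (sorted_list_of_set I)) x"
    by (intro included_in_cong assms) auto
  then show "included_in (I, map (\<lambda>i. x ! (i - 1)) (sorted_list_of_set I)) y"
    by (simp add: included_in_def)
qed

definition zero_at :: "nat set \<Rightarrow> nat list \<Rightarrow> nat list" where
  "zero_at J x = map (\<lambda>i. if i \<in> J then 0 else x ! i) [0..<length x]"

lemma zero_at_empty [simp]: "zero_at {} x = x"
  by (simp add: zero_at_def map_nth)

lemma length_zero_at [simp]: "length (zero_at J x) = length x"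
  by (simp add: zero_at_def)

lemma nth_zero_at [simp]: "i < length x \<Longrightarrow> zero_at J x ! i = (if i \<in> J then 0 else x ! i)"
  by (simp add: zero_at_def)

lemma zero_at_in_tuples:
  assumes "v \<ge> 1" "x \<in> tuples v k"
  shows "zero_at J x \<in> tuples v k"
  using assms by (auto simp: tuples_def zero_at_def subset_eq)

lemma supp_zero_at: "supp (zero_at J x) = supp x - J"
  by (auto simp: supp_def split: if_splits)

text \<open>
  Some \<open>j \<in> T\<close> lies outside the \<open>t\<close>-set \<open>I\<close>, and row \<open>(I, u)\<close> does not notice whether coordinate
  \<open>j\<close> has been set to zero; so \<open>J\<close> and \<open>insert j J\<close> cancel. Coordinates in \<open>I\<close> are numbered
  from 1, those in \<open>T\<close> from 0.
\<close>

lemma alternating_sum_zero_at: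
  assumes Iu: "(I, u) \<in> labelled_tuples t v k" and x: "x \<in> tuples v k"
    and T: "finite T" "card T = Suc t"
  shows "(\<Sum>J\<in>Pow T. (- 1) ^ card J * (if included_in (I, u) (zero_at J x) then 1 else 0 :: real)) = 0"
proof -
  have I: "I \<subseteq> {1..k}" "card I = t" using Iu by (auto simp: labelled_tuples_def)
  then have finI: "finite I" using finite_subset by blast
  have "\<not> Suc ` T \<subseteq> I"
  proof
    assume "Suc ` T \<subseteq> I"
    then have "card (Suc ` T) \<le> card I" using finI card_mono by blast
    then show False using I T by (simp add: card_image)
  qed
  then obtain j where j: "j \<in> T" "Suc j \<notin> I" by blast
  define R where "R = T - {j}"
  have R: "T = insert j R" "j \<notin> R" "finite R" using j T by (auto simp: R_def)
  let ?g = "\<lambda>J. (- 1) ^ card J * (if included_in (I, u) (zero_at J x) then 1 else 0 :: real)"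
  have inj: "inj_on (insert j) (Pow R)" using R(2) by (auto simp: inj_on_def)
  have "sum ?g (Pow T) = sum ?g (Pow R) + sum ?g (insert j ` Pow R)"
    unfolding R(1) Pow_insert using R by (intro sum.union_disjoint) auto
  also have "sum ?g (insert j ` Pow R) = (\<Sum>J\<in>Pow R. - ?g J)"
    unfolding sum.reindex[OF inj] o_def
  proof (rule sum.cong[OF refl])
    fix J assume "J \<in> Pow R"
    then have J: "finite J" "j \<notin> J" using R finite_subset by auto
    have "included_in (I, u) (zero_at (insert j J) x) \<longleftrightarrow> included_in (I, u) (zero_at J x)"
    proof (rule included_in_cong[OF finI])
      fix i assume "i \<in> I"
      then have "1 \<le> i" "i \<le> length x" "i \<noteq> Suc j" using I j x by (auto simp: tuples_def)
      then show "zero_at (insert j J) x ! (i - 1) = zero_at J x ! (i - 1)"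
        by auto
    qed
    then show "?g (insert j J) = - ?g J" using J by simp
  qed
  finally show ?thesis by (simp add: sum_negf)
qed

text \<open>Indexed by the tuple instead of its position, so that the order \<open>cs\<close> of the
  columns disappears.\<close>

definition col_vec :: "(nat set \<times> nat list) list \<Rightarrow> nat list \<Rightarrow> real vec" where
  "col_vec rs x = vec (length rs) (\<lambda>i. if included_in (rs ! i) x then 1 else 0)"

lemma set_cols_inclusion_mat: "set (cols (inclusion_mat rs cs)) = col_vec rs ` set cs"
proof -
  have "cols (inclusion_mat rs cs) = map (col_vec rs) cs"
    by (rule nth_equalityI) (auto simp: inclusion_mat_def col_vec_def)
  then show ?thesis by simp
qed

text \<open>Strong induction on the weight: the alternating relation reduces a tuple of weight above
  \<open>t\<close> to strictly lighter ones.\<close>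

lemma col_vec_in_span:
  assumes "v \<ge> 1" and rs: "set rs \<subseteq> labelled_tuples t v k" and "x \<in> tuples v k"
  shows "col_vec rs x \<in>
    LinearCombinations.module.span class_ring (module_vec TYPE(real) (length rs))
      (col_vec rs ` {x \<in> tuples v k. weight x \<le> t})"
proof -
  interpret vec_space "TYPE(real)" "length rs" .
  let ?S = "col_vec rs ` {x \<in> tuples v k. weight x \<le> t}"
  have S: "?S \<subseteq> carrier_vec (length rs)" by (auto simp: col_vec_def)
  show "col_vec rs x \<in> span ?S"
    using assms(3)
  proof (induction "weight x" arbitrary: x rule: less_induct)
    case less
    show ?case
    proof (cases "weight x \<le> t")
      case True
      then show ?thesis using less.prems S by (intro in_own_span[THEN subsetD]) auto
    next
      case False
      then obtain T where T: "T \<subseteq> supp x" "card T = Suc t"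
        using obtain_subset_with_card_n[of "Suc t" "supp x"] by (auto simp: weight_eq_card_supp)
      have finT: "finite T" using finite_subset[OF T(1)] by simp
      \<comment> \<open>The empty set contributes the column of \<open>x\<close> itself; the other
        terms change sides, hence the reversed sign below.\<close>
      let ?Y = "Pow T - {{}}"
      let ?f = "\<lambda>J. col_vec rs (zero_at J x)"
      have "?f ` ?Y \<subseteq> span ?S"
      proof (rule image_subsetI)
        fix J assume J: "J \<in> ?Y"
        \<comment> \<open>A nonempty \<open>J\<close> inside \<open>supp x\<close> deletes at least
          one nonzero entry.\<close>
        have "supp (zero_at J x) \<subset> supp x" using J T by (auto simp: supp_zero_at)
        then have "weight (zero_at J x) < weight x"
          unfolding weight_eq_card_supp by (intro psubset_card_mono) auto
        then show "?f J \<in> span ?S"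
          using less zero_at_in_tuples[OF assms(1)] by blast
      qed
      then have "vec (length rs) (\<lambda>i. \<Sum>J\<in>?Y. (- ((- 1) ^ card J)) * ?f J $ i) \<in> span ?S"
        using finT by (intro vec_sum_in_span S) auto
      moreover have "vec (length rs) (\<lambda>i. \<Sum>J\<in>?Y. (- ((- 1) ^ card J)) * ?f J $ i) = col_vec rs x"
      proof (rule eq_vecI)
        fix i assume "i < dim_vec (col_vec rs x)"
        then have i: "i < length rs" by (simp add: col_vec_def)
        obtain I u where Iu: "rs ! i = (I, u)" by (cases "rs ! i")
        then have "(I, u) \<in> labelled_tuples t v k" using rs i nth_mem by fastforce
        from alternating_sum_zero_at[OF this less.prems finT T(2)]
        have "(\<Sum>J\<in>Pow T. (- 1) ^ card J * ?f J $ i) = 0"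
          using i Iu by (simp add: col_vec_def)
        then have "col_vec rs x $ i + (\<Sum>J\<in>?Y. (- 1) ^ card J * ?f J $ i) = 0"
          using finT by (subst (asm) sum.remove[of _ "{}"]) auto
        then show "vec (length rs) (\<lambda>i. \<Sum>J\<in>?Y. (- ((- 1) ^ card J)) * ?f J $ i) $ i = col_vec rs x $ i"
          using i by (simp add: sum_negf)
      qed (simp add: col_vec_def)
      ultimately show ?thesis by simp
    qed
  qed
qed

text \<open>
  For \<open>x\<close> of maximal weight with nonzero coefficient, pick a \<open>t\<close>-set \<open>I\<close> containing the support of
  \<open>x\<close>: any other tuple agreeing with \<open>x\<close> on \<open>I\<close> has larger weight, so the row given by \<open>x\<close>
  on \<open>I\<close> sees only the coefficient of \<open>x\<close>.
\<close>

lemma col_vec_independent: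
  assumes "t \<le> k" and rs: "labelled_tuples t v k \<subseteq> set rs"
    and sum0: "\<And>i. i < length rs \<Longrightarrow>
      (\<Sum>x\<in>{x \<in> tuples v k. weight x \<le> t}. c x * col_vec rs x $ i) = 0"
    and x: "x \<in> {x \<in> tuples v k. weight x \<le> t}"
  shows "c x = 0"
  using x
\<comment> \<open>Downward induction on the weight replaces the choice of a maximal
  \<open>x\<close>: the coefficients of all heavier tuples are already known to vanish.\<close>
proof (induction "k - weight x" arbitrary: x rule: less_induct)
  case less
  let ?X = "{x \<in> tuples v k. weight x \<le> t}"
  have lenx: "length x = k" "set x \<subseteq> {0..<v}" using less.prems by (auto simp: tuples_def)
  have "Suc ` supp x \<subseteq> {1..k}" using lenx by (auto simp: supp_def)
  moreover have "card (Suc ` supp x) \<le> t"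
    using less.prems by (simp add: card_image weight_eq_card_supp)
  ultimately obtain I where I: "Suc ` supp x \<subseteq> I" "I \<subseteq> {1..k}" "card I = t"
    using exists_subset_between[of "Suc ` supp x" t "{1..k}"] assms(1) by auto
  have finI: "finite I" using I finite_subset by blast
  define u where "u = map (\<lambda>i. x ! (i - 1)) (sorted_list_of_set I)"
  have "i - 1 < k" if "i \<in> I" for i using that I(2) by fastforce
  then have "x ! (i - 1) \<in> set x" if "i \<in> I" for i using that lenx by simp
  then have "u \<in> tuples v t"
    using I finI lenx by (auto simp: u_def tuples_def subset_eq)
  then have "(I, u) \<in> set rs" using rs I by (auto simp: labelled_tuples_def)
  then obtain r where r: "r < length rs" "rs ! r = (I, u)" by (auto simp: in_set_conv_nth)
  have "(\<Sum>y\<in>?X. c y * col_vec rs y $ r) = (\<Sum>y\<in>?X. if y = x then c y else 0)"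
  proof (rule sum.cong[OF refl])
    fix y assume y: "y \<in> ?X"
    then have leny: "length y = k" by (auto simp: tuples_def)
    show "c y * col_vec rs y $ r = (if y = x then c y else 0)"
    proof (cases "included_in (I, u) y")
      case False
      moreover have "included_in (I, u) x"
        unfolding u_def included_in_restriction_iff[OF finI] by simp
      ultimately show ?thesis using r by (auto simp: col_vec_def)
    next
      case True
      then have agree: "\<And>i. i \<in> I \<Longrightarrow> y ! (i - 1) = x ! (i - 1)"
        unfolding u_def included_in_restriction_iff[OF finI] by blast
      have agree': "y ! i = x ! i" if "i \<in> supp x" for i
        using agree[of "Suc i"] I(1) that by auto
      then have sub: "supp x \<subseteq> supp y" using lenx leny by (auto simp: supp_def)
      show ?thesis
      proof (cases "supp x = supp y")
        case True
        \<comment> \<open>On the common support the row forces agreement; outside it both entries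
          are 0.\<close>
        have "y = x"
        proof (rule nth_equalityI)
          fix i assume "i < length y"
          moreover have "i \<in> supp x \<longleftrightarrow> i \<in> supp y" using True by simp
          ultimately show "y ! i = x ! i" using agree'[of i] lenx leny
            by (cases "i \<in> supp x") (simp_all add: supp_def)
        qed (use lenx leny in simp)
        then show ?thesis using r True \<open>included_in (I, u) y\<close> by (simp add: col_vec_def)
      next
        case False
        then have "supp x \<subset> supp y" using sub by blast
        then have "weight x < weight y"
          unfolding weight_eq_card_supp by (intro psubset_card_mono) auto
        \<comment> \<open>This bound guards against truncated subtraction, so that
          \<open>k - weight y\<close> is strictly smaller than \<open>k - weight x\<close>.\<close>
        moreover have "weight y \<le> k" using y assms(1) by simp
        ultimately have "c y = 0" using less.hyps[of y] y by simp
        then show ?thesis by (cases "y = x") auto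
      qed
    qed
  qed
  also have "\<dots> = c x" using less.prems finite_tuples by simp
  finally show ?case using sum0[OF r(1)] by simp
qed

theorem theorem1:
  fixes v k t :: nat
    and rs :: "(nat set \<times> nat list) list"
    and cs :: "nat list list"
  assumes "v \<ge> 1" and "k \<ge> 1" and "t \<le> k"
    and "enumerates rs (labelled_tuples t v k)"
    and "enumerates cs (tuples v k)"
  shows "vec_space.rank (dim_row (inclusion_mat rs cs)) (inclusion_mat rs cs)
           = (\<Sum>i = 0..t. (k choose i) * (v - 1) ^ i)"
proof -
  interpret vec_space "TYPE(real)" "length rs" .
  have rs: "set rs = labelled_tuples t v k" and cs: "set cs = tuples v k"
    using assms by (auto simp: enumerates_def)
  have "rank (inclusion_mat rs cs) = card {x \<in> tuples v k. weight x \<le> t}"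
  proof (rule rank_eq_card_family[where f = "col_vec rs"])
    show "inclusion_mat rs cs \<in> carrier_mat (length rs) (length cs)"
      by (simp add: inclusion_mat_def)
    \<comment> \<open>Spanning uses that every row is a labelled tuple, independence that every
      labelled tuple occurs as a row.\<close>
    show "set (cols (inclusion_mat rs cs)) \<subseteq> span (col_vec rs ` {x \<in> tuples v k. weight x \<le> t})"
      unfolding set_cols_inclusion_mat cs
      using col_vec_in_span[OF assms(1) eq_refl[OF rs]] by blast
    show "c x = 0" if "\<And>i. i < length rs \<Longrightarrow>
        (\<Sum>x\<in>{x \<in> tuples v k. weight x \<le> t}. c x * col_vec rs x $ i) = 0"
      and "x \<in> {x \<in> tuples v k. weight x \<le> t}" for c x
      using col_vec_independent[OF assms(3) eq_refl[OF rs[symmetric]]] that by blast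
  qed (auto simp: set_cols_inclusion_mat cs finite_tuples)
  then show ?thesis
    by (simp add: card_tuples_weight_le[OF assms(1)] inclusion_mat_def)
qed

end
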